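(* Let $s\ge1$ and $n_1\ge n_2\ge\dots\ge n_s>0$ be integers. Let $\mathfrak g$ be the complex vector space with basis $e_0,f_0,e^i_j,f^i_j$ ($i=1,\dots,s$, $j=1,\dots,n_i$), set $e^i_0=e_0$, $f^i_0=f_0$ for all $i$, and define a bracket by $[e^i_j,f^i_k]=e^i_{j-k}$ for $0\le k\le j\le n_i$, all other brackets of basis elements (not determined by these relations and antisymmetry) being zero. Then $\mathfrak g$ is a Lie algebra, and its Jordan–Kronecker invariants consist of the single Jordan tuple $J_\lambda(2n_1+2,2n_2,\dots,2n_s)$ (and no Kronecker blocks).
   Context: For a finite-dimensional complex Lie algebra $\mathfrak g$ and $x\in\mathfrak g^*$, let $\mathcal A_x$ be the skew form $(\xi,\eta)\mapsto\langle x,[\xi,\eta]\rangle$. By the Jordan–Kronecker theorem, a pair of skew forms on a finite-dimensional complex vector space admits a basis in which both are block-diagonal with blocks of types: Jordan $2n\times2n$ blocks with eigenvalue $\mu\in\mathbb C\cup\{\infty\}$ ($A_i=\begin{pmatrix}0&J_\mu\\-J_\mu^T&0\end{pmatrix}$, $B_i=\begin{pmatrix}0&I_n\\-I_n&0\end{pmatrix}$), and Kronecker $(2k-1)\times(2k-1)$ blocks; block data grouped by eigenvalue are unique. The JK invariants of $\mathfrak g$ are the Kronecker sizes and Jordan tuples $J_{\lambda_i}(2n_{i1},\dots,2n_{is_i})$ (sizes of Jordan blocks with a common eigenvalue $\lambda_i$, in decreasing order) of $(\mathcal A_x,\mathcal A_a)$ for $(x,a)$ in a nonempty Zariski open subset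 of $\mathfrak g^*\times\mathfrak g^*$ where these are constant. *)

theory Defs
  imports Complex_Main
begin

text \<open>Block types: Jor mu m is a Jordan block of size 2m with eigenvalue mu, where
  None stands for the eigenvalue infinity; Kron k is a Kronecker block of size 2k-1.\<close>

datatype jk_block = Jor "complex option" nat | Kron nat

fun bsize :: "jk_block \<Rightarrow> nat" where
  "bsize (Jor mu m) = 2 * m"
| "bsize (Kron k) = 2 * k - 1"

definition skewblk :: "nat \<Rightarrow> (nat \<Rightarrow> nat \<Rightarrow> complex) \<Rightarrow> nat \<Rightarrow> nat \<Rightarrow> complex" where
  "skewblk m M p q =
     (if p < m \<and> m \<le> q then M p (q - m)
      else if m \<le> p \<and> q < m then - M q (p - m)
      else 0)"

definition jordan_mat :: "complex \<Rightarrow> nat \<Rightarrow> nat \<Rightarrow> complex" where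
  "jordan_mat mu p q = (if p = q then mu else if q = Suc p then 1 else 0)"

definition id_mat :: "nat \<Rightarrow> nat \<Rightarrow> complex" where
  "id_mat p q = (if p = q then 1 else 0)"

text \<open>Kronecker block pieces (k x (k-1) matrices).\<close>
definition kron1 :: "nat \<Rightarrow> nat \<Rightarrow> complex" where
  "kron1 p q = (if p = q then 1 else 0)"

definition kron2 :: "nat \<Rightarrow> nat \<Rightarrow> complex" where
  "kron2 p q = (if p = Suc q then 1 else 0)"

fun blkA :: "jk_block \<Rightarrow> nat \<Rightarrow> nat \<Rightarrow> complex" where
  "blkA (Jor (Some mu) m) = skewblk m (jordan_mat mu)"
| "blkA (Jor None m) = skewblk m id_mat"
| "blkA (Kron k) = skewblk k kron1"

fun blkB :: "jk_block \<Rightarrow> nat \<Rightarrow> nat \<Rightarrow> complex" where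
  "blkB (Jor (Some mu) m) = skewblk m id_mat"
| "blkB (Jor None m) = skewblk m (jordan_mat 0)"
| "blkB (Kron k) = skewblk k kron2"

definition bform :: "'i set \<Rightarrow> ('i \<Rightarrow> 'i \<Rightarrow> complex) \<Rightarrow> ('i \<Rightarrow> complex) \<Rightarrow> ('i \<Rightarrow> complex) \<Rightarrow> complex" where
  "bform I M u w = (\<Sum>i\<in>I. \<Sum>j\<in>I. u i * M i j * w j)"

definition jk_pos :: "jk_block list \<Rightarrow> (nat \<times> nat) set" where
  "jk_pos bs = {(k, l). k < length bs \<and> l < bsize (bs ! k)}"

text \<open>v k l (k a block, l a position in the block) is a basis of C^I in which the
  pair of forms (A, B) is block diagonal with the JK blocks bs.\<close>
definition jk_decomp :: "'i set \<Rightarrow> ('i \<Rightarrow> 'i \<Rightarrow> complex) \<Rightarrow> ('i \<Rightarrow> 'i \<Rightarrow> complex)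
    \<Rightarrow> jk_block list \<Rightarrow> (nat \<Rightarrow> nat \<Rightarrow> 'i \<Rightarrow> complex) \<Rightarrow> bool" where
  "jk_decomp I A B bs v \<longleftrightarrow>
     finite I \<and>
     card (jk_pos bs) = card I \<and>
     (\<forall>(k, l)\<in>jk_pos bs. \<forall>i. i \<notin> I \<longrightarrow> v k l i = 0) \<and>
     (\<forall>c. (\<forall>i. (\<Sum>(k, l)\<in>jk_pos bs. c k l * v k l i) = 0) \<longrightarrow> (\<forall>(k, l)\<in>jk_pos bs. c k l = 0)) \<and>
     (\<forall>(k, l)\<in>jk_pos bs. \<forall>(k', l')\<in>jk_pos bs.
        bform I A (v k l) (v k' l') = (if k = k' then blkA (bs ! k) l l' else 0) \<and>
        bform I B (v k l) (v k' l') = (if k = k' then blkB (bs ! k) l l' else 0))"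

definition aff :: "'i set \<Rightarrow> ('i \<Rightarrow> complex) set" where
  "aff I = {z. \<forall>i. i \<notin> I \<longrightarrow> z i = 0}"

inductive poly_on :: "'i set \<Rightarrow> (('i \<Rightarrow> complex) \<Rightarrow> complex) \<Rightarrow> bool" for I where
  pconst: "poly_on I (\<lambda>z. c)"
| pcoord: "i \<in> I \<Longrightarrow> poly_on I (\<lambda>z. z i)"
| padd: "poly_on I p \<Longrightarrow> poly_on I q \<Longrightarrow> poly_on I (\<lambda>z. p z + q z)"
| pmult: "poly_on I p \<Longrightarrow> poly_on I q \<Longrightarrow> poly_on I (\<lambda>z. p z * q z)"

definition zariski_open :: "'i set \<Rightarrow> ('i \<Rightarrow> complex) set \<Rightarrow> bool" where
  "zariski_open I U \<longleftrightarrow>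
     (\<exists>P. (\<forall>p\<in>P. poly_on I p) \<and> U = {z \<in> aff I. \<exists>p\<in>P. p z \<noteq> 0})"

definition lie_algebra :: "('i \<Rightarrow> complex) set \<Rightarrow> (('i \<Rightarrow> complex) \<Rightarrow> ('i \<Rightarrow> complex) \<Rightarrow> ('i \<Rightarrow> complex)) \<Rightarrow> bool" where
  "lie_algebra V br \<longleftrightarrow>
     (\<lambda>i. 0) \<in> V \<and> (\<forall>u\<in>V. \<forall>w\<in>V. (\<lambda>i. u i + w i) \<in> V) \<and> (\<forall>c. \<forall>u\<in>V. (\<lambda>i. c * u i) \<in> V) \<and>
     (\<forall>u\<in>V. \<forall>w\<in>V. br u w \<in> V) \<and>
     (\<forall>u\<in>V. \<forall>u'\<in>V. \<forall>w\<in>V. br (\<lambda>i. u i + u' i) w = (\<lambda>i. br u w i + br u' w i) \<and>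
                               br w (\<lambda>i. u i + u' i) = (\<lambda>i. br w u i + br w u' i)) \<and>
     (\<forall>c. \<forall>u\<in>V. \<forall>w\<in>V. br (\<lambda>i. c * u i) w = (\<lambda>i. c * br u w i) \<and> br w (\<lambda>i. c * u i) = (\<lambda>i. c * br w u i)) \<and>
     (\<forall>u\<in>V. br u u = (\<lambda>i. 0)) \<and>
     (\<forall>u\<in>V. \<forall>v\<in>V. \<forall>w\<in>V. (\<lambda>i. br u (br v w) i + br v (br w u) i + br w (br u v) i) = (\<lambda>i. 0))"

text \<open>E i j stands for e^i_j (1 <= i <= s, 1 <= j <= n i), E 0 0 for e_0; similarly F.\<close>
datatype gidx = E nat nat | F nat nat

definition gbasis :: "nat \<Rightarrow> (nat \<Rightarrow> nat) \<Rightarrow> gidx set" where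
  "gbasis s n = {E 0 0, F 0 0}
     \<union> {E i j | i j. 1 \<le> i \<and> i \<le> s \<and> 1 \<le> j \<and> j \<le> n i}
     \<union> {F i j | i j. 1 \<le> i \<and> i \<le> s \<and> 1 \<le> j \<and> j \<le> n i}"

definition eidx :: "nat \<Rightarrow> nat \<Rightarrow> gidx" where
  "eidx i j = (if j = 0 then E 0 0 else E i j)"

definition fidx :: "nat \<Rightarrow> nat \<Rightarrow> gidx" where
  "fidx i j = (if j = 0 then F 0 0 else F i j)"

definition grel :: "nat \<Rightarrow> (nat \<Rightarrow> nat) \<Rightarrow> nat \<Rightarrow> nat \<Rightarrow> nat \<Rightarrow> bool" where
  "grel s n i j k \<longleftrightarrow> 1 \<le> i \<and> i \<le> s \<and> k \<le> j \<and> j \<le> n i"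

text \<open>Structure constants: gbr_basis s n a b c is the c-coordinate of [a, b]:
  [e^i_j, f^i_k] = e^i_(j-k) for 0 <= k <= j <= n_i, antisymmetry, all else zero.\<close>
definition gbr_basis :: "nat \<Rightarrow> (nat \<Rightarrow> nat) \<Rightarrow> gidx \<Rightarrow> gidx \<Rightarrow> gidx \<Rightarrow> complex" where
  "gbr_basis s n a b c =
     (if \<exists>i j k. grel s n i j k \<and> a = eidx i j \<and> b = fidx i k \<and> c = eidx i (j - k) then 1 else 0)
   - (if \<exists>i j k. grel s n i j k \<and> b = eidx i j \<and> a = fidx i k \<and> c = eidx i (j - k) then 1 else 0)"

definition gspace :: "nat \<Rightarrow> (nat \<Rightarrow> nat) \<Rightarrow> (gidx \<Rightarrow> complex) set" where
  "gspace s n = aff (gbasis s n)"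

definition gbr :: "nat \<Rightarrow> (nat \<Rightarrow> nat) \<Rightarrow> (gidx \<Rightarrow> complex) \<Rightarrow> (gidx \<Rightarrow> complex) \<Rightarrow> (gidx \<Rightarrow> complex)" where
  "gbr s n u w = (\<lambda>c. \<Sum>a\<in>gbasis s n. \<Sum>b\<in>gbasis s n. u a * w b * gbr_basis s n a b c)"

text \<open>Gram matrix of A_x(xi, eta) = <x, [xi, eta]> in the basis, x given in the dual basis.\<close>
definition lie_form :: "nat \<Rightarrow> (nat \<Rightarrow> nat) \<Rightarrow> (gidx \<Rightarrow> complex) \<Rightarrow> gidx \<Rightarrow> gidx \<Rightarrow> complex" where
  "lie_form s n x a b = (\<Sum>c\<in>gbasis s n. x c * gbr_basis s n a b c)"

end

theory Submission
  imports Defs "HOL-Computational_Algebra.Formal_Power_Series"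
begin

unbundle fps_syntax

text \<open>Let R be the local algebra with generators t_1, ..., t_s and relations t_i t_j = 0 for i \<noteq> j and
  t_i^(n_i + 1) = 0. The span of the f^i_k is R (f^i_k corresponds to t_i^k), the span of the e^i_j is
  the dual module, with e^i_j dual to t_i^j, and the Lie algebra is the semidirect product of the two;
  the Jacobi identity is the commutativity of R. The form of x pairs e with f to e(f p), where p in R
  is the e-part of x. If q is the e-part of a, then q is generically a unit and p / q = \<lambda> + r, where r
  lies in the maximal ideal and each of its components r_i in t_i C[t_i] generically has a nonzero linear term.
  Multiplication by r has the Jordan chains 1, r, ..., r^(n_1) and r_i, ..., r_i^(n_i) for i \<ge> 2.
  The vectors in the first halves of the blocks form these chains, those in the second halves the basis
  dual to them with respect to the form of a. The dual basis is explicit: coordinates in powers of r_i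
  are the coefficients after composing with the compositional inverse of the power series r_i.\<close>

section \<open>The Lie algebra as a semidirect product\<close>

text \<open>One half of the structure constants; the other half is its transpose with a minus sign.
  The existential over i is needed since e_0 and f_0 lie in every branch i.\<close>

definition act_rel :: "nat \<Rightarrow> (nat \<Rightarrow> nat) \<Rightarrow> gidx \<Rightarrow> gidx \<Rightarrow> gidx \<Rightarrow> bool" where
  "act_rel s n a b c \<longleftrightarrow>
     (\<exists>i j k. grel s n i j k \<and> a = eidx i j \<and> b = fidx i k \<and> c = eidx i (j - k))"

text \<open>For e-components of u and f-components of w this is the module action of R on its dual.\<close>
definition act :: "nat \<Rightarrow> (nat \<Rightarrow> nat) \<Rightarrow> (gidx \<Rightarrow> complex) \<Rightarrow> (gidx \<Rightarrow> complex) \<Rightarrow> gidx \<Rightarrow> complex" where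
  "act s n u w c = (\<Sum>a\<in>gbasis s n. \<Sum>b\<in>gbasis s n. u a * w b * of_bool (act_rel s n a b c))"

lemma gbr_basis_eq:
  "gbr_basis s n a b c = of_bool (act_rel s n a b c) - of_bool (act_rel s n b a c)"
  unfolding gbr_basis_def act_rel_def of_bool_def by (rule refl)

section \<open>Indices and dimension\<close>

lemma eidx_eq_iff: "eidx i j = eidx i' j' \<longleftrightarrow> j = j' \<and> (j = 0 \<or> i = i')"
  by (auto simp: eidx_def)

lemma fidx_eq_iff: "fidx i k = fidx i' k' \<longleftrightarrow> k = k' \<and> (k = 0 \<or> i = i')"
  by (auto simp: fidx_def)

lemma eidx_neq_fidx [simp]: "eidx i j \<noteq> fidx i' j'" "fidx i' j' \<noteq> eidx i j"
  by (auto simp: eidx_def fidx_def)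

lemma eidx_in_gbasis [simp]: "1 \<le> i \<Longrightarrow> i \<le> s \<Longrightarrow> j \<le> n i \<Longrightarrow> eidx i j \<in> gbasis s n"
  by (auto simp: eidx_def gbasis_def)

lemma fidx_in_gbasis [simp]: "1 \<le> i \<Longrightarrow> i \<le> s \<Longrightarrow> j \<le> n i \<Longrightarrow> fidx i j \<in> gbasis s n"
  by (auto simp: fidx_def gbasis_def)

lemma gbasis_eq:
  "gbasis s n = insert (E 0 0) (case_prod E ` Sigma {1..s} (\<lambda>i. {1..n i}))
              \<union> insert (F 0 0) (case_prod F ` Sigma {1..s} (\<lambda>i. {1..n i}))"
  by (auto simp: gbasis_def image_iff)

lemma finite_gbasis [simp]: "finite (gbasis s n)"
  unfolding gbasis_eq by simp

lemma card_gbasis: "card (gbasis s n) = 2 * (1 + (\<Sum>i=1..s. n i))"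
proof -
  let ?S = "Sigma {1..s} (\<lambda>i. {1..n i})"
  have E: "card (insert (E 0 0) (case_prod E ` ?S)) = 1 + (\<Sum>i=1..s. n i)"
  proof -
    have "inj_on (case_prod E) ?S" by (auto simp: inj_on_def)
    moreover have "E 0 0 \<notin> case_prod E ` ?S" by auto
    ultimately show ?thesis by (simp add: card_image)
  qed
  have F: "card (insert (F 0 0) (case_prod F ` ?S)) = 1 + (\<Sum>i=1..s. n i)"
  proof -
    have "inj_on (case_prod F) ?S" by (auto simp: inj_on_def)
    moreover have "F 0 0 \<notin> case_prod F ` ?S" by auto
    ultimately show ?thesis by (simp add: card_image)
  qed
  show ?thesis
    unfolding gbasis_eq by (subst card_Un_disjoint) (auto simp: E[simplified] F[simplified])
qed

section \<open>Commutativity of the action\<close>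

text \<open>For j = 0 the index does not determine i, but then k = 0 and the triple is e_0, f_0, e_0
  in every branch, so the given i can be kept.\<close>

lemma act_rel_eidx_iff:
  assumes "1 \<le> i" "i \<le> s" "j \<le> n i"
  shows "act_rel s n (eidx i j) b c \<longleftrightarrow> (\<exists>k\<le>j. b = fidx i k \<and> c = eidx i (j - k))"
proof
  assume "act_rel s n (eidx i j) b c"
  then obtain i' j' k where g: "grel s n i' j' k" and e: "eidx i j = eidx i' j'"
    and b: "b = fidx i' k" and c: "c = eidx i' (j' - k)"
    unfolding act_rel_def by blast
  have "j' = j" "j = 0 \<or> i' = i" using e by (auto simp: eidx_eq_iff)
  with g b c show "\<exists>k\<le>j. b = fidx i k \<and> c = eidx i (j - k)"
    by (auto simp: grel_def eidx_eq_iff fidx_eq_iff intro!: exI[of _ k])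
next
  assume "\<exists>k\<le>j. b = fidx i k \<and> c = eidx i (j - k)"
  with assms show "act_rel s n (eidx i j) b c"
    unfolding act_rel_def grel_def by blast
qed

lemma act_rel_in_gbasis: "act_rel s n a b c \<Longrightarrow> a \<in> gbasis s n \<and> b \<in> gbasis s n \<and> c \<in> gbasis s n"
  unfolding act_rel_def grel_def by auto

lemma act_rel_kinds:
  "act_rel s n a b c \<Longrightarrow> (\<exists>i j. a = eidx i j) \<and> (\<exists>i k. b = fidx i k) \<and> (\<exists>i j. c = eidx i j)"
  unfolding act_rel_def by blast

lemma act_rel_unique: "act_rel s n a b c \<Longrightarrow> act_rel s n a b c' \<Longrightarrow> c = c'"
  unfolding act_rel_def by (auto simp: eidx_eq_iff fidx_eq_iff)

text \<open>The monomials t_i^k and t_i^k' of R commute: lowering j by k and then by k' can be done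
  in the other order.\<close>

lemma act_rel_commute:
  assumes "act_rel s n a b d" "act_rel s n d c e"
  shows "\<exists>d'. act_rel s n a c d' \<and> act_rel s n d' b e"
proof -
  obtain i j k where g: "1 \<le> i" "i \<le> s" "k \<le> j" "j \<le> n i"
    and a: "a = eidx i j" "b = fidx i k" and d: "d = eidx i (j - k)"
    using assms(1) unfolding act_rel_def grel_def by blast
  \<comment> \<open>Even if d is e_0, common to all branches, \<open>act_rel_eidx_iff\<close> keeps
    the second step in branch i.\<close>
  then obtain k' where k': "k' \<le> j - k" "c = fidx i k'" "e = eidx i (j - k - k')"
    using assms(2) act_rel_eidx_iff[of i s "j - k" n c e] by auto
  have "act_rel s n a c (eidx i (j - k'))"
    using g k' by (auto simp: a act_rel_eidx_iff intro!: exI[of _ k'])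
  moreover have "act_rel s n (eidx i (j - k')) b e"
    using g k' by (auto simp: a act_rel_eidx_iff intro!: exI[of _ k] arg_cong[of _ _ "eidx i"])
  ultimately show ?thesis by blast
qed

lemma sum_act_rel:
  "(\<Sum>d\<in>gbasis s n. of_bool (act_rel s n a b d) * of_bool (act_rel s n d c e) :: complex)
     = of_bool (\<exists>d. act_rel s n a b d \<and> act_rel s n d c e)"
proof (cases "\<exists>d. act_rel s n a b d \<and> act_rel s n d c e")
  case True
  then obtain d where d: "act_rel s n a b d" "act_rel s n d c e" by blast
  have "(act_rel s n a b d' \<and> act_rel s n d' c e) = (d' = d)" for d'
    using d act_rel_unique by blast
  then show ?thesis
    using act_rel_in_gbasis[OF d(1)] by (auto simp: of_bool_conj[symmetric])
next
  case False
  then show ?thesis by (auto intro!: sum.neutral)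
qed

text \<open>Moving the sum over d innermost leaves a 0/1 coefficient for each triple, so that
  commutation of the actions becomes symmetry of this coefficient in b and c.\<close>

lemma act_act:
  "act s n (act s n u v) w e = (\<Sum>a\<in>gbasis s n. \<Sum>b\<in>gbasis s n. \<Sum>c\<in>gbasis s n.
     u a * v b * w c * of_bool (\<exists>d. act_rel s n a b d \<and> act_rel s n d c e))"
proof -
  let ?I = "gbasis s n" and ?T = "\<lambda>a b c. of_bool (act_rel s n a b c) :: complex"
  have "act s n (act s n u v) w e =
      (\<Sum>d\<in>?I. \<Sum>c\<in>?I. \<Sum>a\<in>?I. \<Sum>b\<in>?I. u a * v b * w c * (?T a b d * ?T d c e))"
    unfolding act_def by (simp add: sum_distrib_right sum_distrib_left mult_ac)
  also have "\<dots> = (\<Sum>c\<in>?I. \<Sum>d\<in>?I. \<Sum>a\<in>?I. \<Sum>b\<in>?I. u a * v b * w c * (?T a b d * ?T d c e))"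
    by (rule sum.swap)
  also have "\<dots> = (\<Sum>c\<in>?I. \<Sum>a\<in>?I. \<Sum>d\<in>?I. \<Sum>b\<in>?I. u a * v b * w c * (?T a b d * ?T d c e))"
    by (intro sum.cong refl sum.swap)
  also have "\<dots> = (\<Sum>c\<in>?I. \<Sum>a\<in>?I. \<Sum>b\<in>?I. \<Sum>d\<in>?I. u a * v b * w c * (?T a b d * ?T d c e))"
    by (intro sum.cong refl sum.swap)
  also have "\<dots> = (\<Sum>a\<in>?I. \<Sum>c\<in>?I. \<Sum>b\<in>?I. \<Sum>d\<in>?I. u a * v b * w c * (?T a b d * ?T d c e))"
    by (rule sum.swap)
  also have "\<dots> = (\<Sum>a\<in>?I. \<Sum>b\<in>?I. \<Sum>c\<in>?I. \<Sum>d\<in>?I. u a * v b * w c * (?T a b d * ?T d c e))"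
    by (intro sum.cong refl sum.swap)
  also have "\<dots> = (\<Sum>a\<in>?I. \<Sum>b\<in>?I. \<Sum>c\<in>?I.
     u a * v b * w c * of_bool (\<exists>d. act_rel s n a b d \<and> act_rel s n d c e))"
    by (simp only: sum_distrib_left[symmetric] sum_act_rel)
  finally show ?thesis .
qed

lemma act_act_commute: "act s n (act s n u v) w = act s n (act s n u w) v"
proof
  fix e
  have comm: "(\<exists>d. act_rel s n a b d \<and> act_rel s n d c e) \<longleftrightarrow>
      (\<exists>d. act_rel s n a c d \<and> act_rel s n d b e)" for a b c
    using act_rel_commute by metis
  have "act s n (act s n u v) w e = (\<Sum>a\<in>gbasis s n. \<Sum>c\<in>gbasis s n. \<Sum>b\<in>gbasis s n.
     u a * v b * w c * of_bool (\<exists>d. act_rel s n a b d \<and> act_rel s n d c e))"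
    unfolding act_act by (intro sum.cong refl sum.swap)
  also have "\<dots> = act s n (act s n u w) v e"
    unfolding act_act by (intro sum.cong refl) (simp add: comm mult_ac)
  finally show "act s n (act s n u v) w e = act s n (act s n u w) v e" .
qed

text \<open>The inner action takes values in the span of the e^i_j, while the outer one sees only
  the f-components of its second argument.\<close>

lemma act_act_right: "act s n u (act s n v w) c = 0"
proof -
  have "act s n v w b * of_bool (act_rel s n a b c) = 0" for a b
  proof (cases "act_rel s n a b c")
    case True
    then obtain i k where "b = fidx i k" using act_rel_kinds by blast
    then have "\<not> act_rel s n a' b' b" for a' b'
      using act_rel_kinds[of s n a' b' b] by auto
    then show ?thesis by (simp add: act_def)
  qed simp
  then show ?thesis unfolding act_def[of s n u] by (simp only: mult.assoc mult_zero_right sum.neutral_const)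
qed

section \<open>The bracket and the Jacobi identity\<close>

lemma gbr_eq: "gbr s n u w c = act s n u w c - act s n w u c"
proof -
  have "act s n w u c = (\<Sum>a\<in>gbasis s n. \<Sum>b\<in>gbasis s n. u a * w b * of_bool (act_rel s n b a c))"
    unfolding act_def by (subst sum.swap) (simp add: mult_ac)
  then show ?thesis
    unfolding gbr_def by (simp add: act_def gbr_basis_eq algebra_simps sum_subtractf)
qed

lemma act_add_left: "act s n (\<lambda>i. u i + u' i) w c = act s n u w c + act s n u' w c"
  unfolding act_def by (simp add: algebra_simps sum.distrib)

lemma act_add_right: "act s n w (\<lambda>i. u i + u' i) c = act s n w u c + act s n w u' c"
  unfolding act_def by (simp add: algebra_simps sum.distrib)

lemma act_scale_left: "act s n (\<lambda>i. k * u i) w c = k * act s n u w c"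
  unfolding act_def by (simp add: algebra_simps sum_distrib_left)

lemma act_scale_right: "act s n w (\<lambda>i. k * u i) c = k * act s n w u c"
  unfolding act_def by (simp add: algebra_simps sum_distrib_left)

lemma act_diff_left: "act s n (\<lambda>i. u i - u' i) w c = act s n u w c - act s n u' w c"
  unfolding act_def by (simp add: algebra_simps sum_subtractf)

lemma act_diff_right: "act s n w (\<lambda>i. u i - u' i) c = act s n w u c - act s n w u' c"
  unfolding act_def by (simp add: algebra_simps sum_subtractf)

text \<open>By \<open>act_act_right\<close> only the terms with the inner bracket in the first
  argument of \<open>act\<close> survive; these six cancel in pairs by
  \<open>act_act_commute\<close>.\<close>

lemma gbr_jacobi:
  "gbr s n u (gbr s n v w) c + gbr s n v (gbr s n w u) c + gbr s n w (gbr s n u v) c = 0"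
proof -
  have "gbr s n x (gbr s n y z) c = act s n (act s n z y) x c - act s n (act s n y z) x c" for x y z
    by (simp add: gbr_eq[of s n x] gbr_eq[of s n y z, abs_def] act_diff_left act_diff_right act_act_right)
  then show ?thesis
    by (simp add: act_act_commute[of s n w v u] act_act_commute[of s n v w u] act_act_commute[of s n u w v])
qed

lemma lie_algebra_gspace: "lie_algebra (gspace s n) (gbr s n)"
proof -
  have closed: "gbr s n u w \<in> gspace s n" for u w
  proof -
    have "gbr s n u w c = 0" if "c \<notin> gbasis s n" for c
    proof -
      have "\<not> act_rel s n a b c" for a b using that act_rel_in_gbasis by blast
      then show ?thesis by (simp add: gbr_eq act_def)
    qed
    then show ?thesis by (simp add: gspace_def aff_def)
  qed
  have linear: "gbr s n (\<lambda>i. u i + u' i) w = (\<lambda>i. gbr s n u w i + gbr s n u' w i)"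
    "gbr s n w (\<lambda>i. u i + u' i) = (\<lambda>i. gbr s n w u i + gbr s n w u' i)"
    "gbr s n (\<lambda>i. k * u i) w = (\<lambda>i. k * gbr s n u w i)"
    "gbr s n w (\<lambda>i. k * u i) = (\<lambda>i. k * gbr s n w u i)" for u u' w k
    by (simp_all add: gbr_eq fun_eq_iff act_add_left act_add_right act_scale_left act_scale_right
        right_diff_distrib)
  have alternating: "gbr s n u u = (\<lambda>i. 0)" for u
    by (simp add: gbr_eq fun_eq_iff)
  have subspace: "(\<lambda>i. 0) \<in> gspace s n" "u \<in> gspace s n \<Longrightarrow> (\<lambda>i. k * u i) \<in> gspace s n"
    "u \<in> gspace s n \<Longrightarrow> w \<in> gspace s n \<Longrightarrow> (\<lambda>i. u i + w i) \<in> gspace s n" for u w k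
    by (simp_all add: gspace_def aff_def)
  show ?thesis
    unfolding lie_algebra_def linear alternating gbr_jacobi by (simp add: subspace closed)
qed

section \<open>Block decompositions from dual bases\<close>

lemma bform_sum_right:
  "bform I M u (\<lambda>i. \<Sum>p\<in>S. c p * v p i) = (\<Sum>p\<in>S. c p * bform I M u (v p))"
proof -
  have "bform I M u (\<lambda>i. \<Sum>p\<in>S. c p * v p i) = (\<Sum>i\<in>I. \<Sum>j\<in>I. \<Sum>p\<in>S. c p * (u i * M i j * v p j))"
    unfolding bform_def by (simp add: sum_distrib_left mult_ac)
  also have "\<dots> = (\<Sum>i\<in>I. \<Sum>p\<in>S. \<Sum>j\<in>I. c p * (u i * M i j * v p j))"
    by (intro sum.cong refl sum.swap)
  also have "\<dots> = (\<Sum>p\<in>S. \<Sum>i\<in>I. \<Sum>j\<in>I. c p * (u i * M i j * v p j))"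
    by (rule sum.swap)
  finally show ?thesis by (simp add: bform_def sum_distrib_left)
qed

lemma bform_diff_right: "bform I M u (\<lambda>i. v i - w i) = bform I M u v - bform I M u w"
  unfolding bform_def by (simp add: algebra_simps sum_subtractf)

lemma bform_minus_right: "bform I M u (\<lambda>i. - v i) = - bform I M u v"
  unfolding bform_def by (simp add: sum_negf)

lemma bform_zero_right: "bform I M u (\<lambda>i. 0) = 0"
  unfolding bform_def by simp

lemma bform_antisym:
  assumes "\<And>i j. M j i = - M i j"
  shows "bform I M w u = - bform I M u w"
proof -
  have "bform I M w u = (\<Sum>i\<in>I. \<Sum>j\<in>I. w j * M j i * u i)"
    unfolding bform_def by (rule sum.swap)
  also have "\<dots> = (\<Sum>i\<in>I. \<Sum>j\<in>I. - (u i * M i j * w j))"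
    by (intro sum.cong refl) (subst assms, simp)
  finally show ?thesis by (simp add: bform_def sum_negf)
qed

lemma jk_pos_map_Jor:
  "jk_pos (map (Jor mu) ms) = Sigma {..<length ms} (\<lambda>k. {..<2 * ms ! k})"
  by (auto simp: jk_pos_def)

text \<open>Linear independence is automatic: it follows from the nondegeneracy of the Gram matrix of B.\<close>
lemma jk_decomp_JorI:
  fixes ms :: "nat list"
  assumes fin: "finite I" and card: "card I = 2 * sum_list ms"
    and supp: "\<And>k l i. i \<notin> I \<Longrightarrow> u k l i = 0" "\<And>k l i. i \<notin> I \<Longrightarrow> w k l i = 0"
    and antisym: "\<And>i j. A j i = - A i j" "\<And>i j. B j i = - B i j"
    and isotropic: "\<And>k l k' l'. bform I A (u k l) (u k' l') = 0" "\<And>k l k' l'. bform I A (w k l) (w k' l') = 0"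
       "\<And>k l k' l'. bform I B (u k l) (u k' l') = 0" "\<And>k l k' l'. bform I B (w k l) (w k' l') = 0"
    and pairA: "\<And>k l k' l'. \<lbrakk>k < length ms; k' < length ms; l < ms ! k; l' < ms ! k'\<rbrakk> \<Longrightarrow>
       bform I A (u k l) (w k' l') = (if k = k' then jordan_mat mu l l' else 0)"
    and pairB: "\<And>k l k' l'. \<lbrakk>k < length ms; k' < length ms; l < ms ! k; l' < ms ! k'\<rbrakk> \<Longrightarrow>
       bform I B (u k l) (w k' l') = (if k = k' then id_mat l l' else 0)"
  shows "jk_decomp I A B (map (Jor (Some mu)) ms)
    (\<lambda>k l. if l < ms ! k then u k l else w k (l - ms ! k))"
proof -
  define v where "v k l = (if l < ms ! k then u k l else w k (l - ms ! k))" for k l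
  let ?P = "Sigma {..<length ms} (\<lambda>k. {..<2 * ms ! k})"
  note anti = bform_antisym[of A, OF antisym(1)] bform_antisym[of B, OF antisym(2)]
  have gram:
    "bform I A (v k l) (v k' l') = (if k = k' then skewblk (ms ! k) (jordan_mat mu) l l' else 0)"
    "bform I B (v k l) (v k' l') = (if k = k' then skewblk (ms ! k) id_mat l l' else 0)"
    if kl: "k < length ms" "l < 2 * ms ! k" "k' < length ms" "l' < 2 * ms ! k'" for k l k' l'
  proof -
    have "bform I A (v k l) (v k' l') = (if k = k' then skewblk (ms ! k) (jordan_mat mu) l l' else 0) \<and>
      bform I B (v k l) (v k' l') = (if k = k' then skewblk (ms ! k) id_mat l l' else 0)"
    proof (cases "l < ms ! k")
      case True
      show ?thesis
      proof (cases "l' < ms ! k'")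
        case True
        with \<open>l < ms ! k\<close> show ?thesis by (auto simp: v_def isotropic skewblk_def)
      next
        case False
        then have "l' - ms ! k' < ms ! k'" using kl by simp
        with \<open>l < ms ! k\<close> False kl show ?thesis by (auto simp: v_def pairA pairB skewblk_def)
      qed
    next
      case outer: False
      then have l: "l - ms ! k < ms ! k" using kl by simp
      show ?thesis
      proof (cases "l' < ms ! k'")
        case True
        have "bform I A (v k l) (v k' l') = - bform I A (u k' l') (w k (l - ms ! k))"
          "bform I B (v k l) (v k' l') = - bform I B (u k' l') (w k (l - ms ! k))"
          using True outer by (simp_all add: v_def anti[of _ "w k (l - ms ! k)"])
        with True outer l kl show ?thesis by (auto simp: pairA pairB skewblk_def)
      next
        case False
        with outer show ?thesis by (auto simp: v_def isotropic skewblk_def)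
      qed
    qed
    then show "bform I A (v k l) (v k' l') = (if k = k' then skewblk (ms ! k) (jordan_mat mu) l l' else 0)"
      "bform I B (v k l) (v k' l') = (if k = k' then skewblk (ms ! k) id_mat l l' else 0)" by blast+
  qed
  have indep: "c k l = 0"
    if c: "\<forall>i. (\<Sum>(k, l)\<in>?P. c k l * v k l i) = 0" and kl: "k < length ms" "l < 2 * ms ! k" for c k l
  proof -
    \<comment> \<open>q is the position that B pairs with l. The Gram matrix of B is a signed
      permutation matrix, so pairing a vanishing combination with \<open>v k q\<close> isolates
      \<open>c k l\<close> up to sign.\<close>
    define q where "q = (if l < ms ! k then ms ! k + l else l - ms ! k)"
    have q: "q < 2 * ms ! k" using kl by (auto simp: q_def)
    have sgn: "skewblk (ms ! k) id_mat q l' = (if l' = l then (if l < ms ! k then - 1 else 1) else 0)"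
      if "l' < 2 * ms ! k" for l'
      using that kl by (auto simp: skewblk_def id_mat_def q_def)
    have "0 = bform I B (v k q) (\<lambda>i. \<Sum>p\<in>?P. c (fst p) (snd p) * v (fst p) (snd p) i)"
      using c by (simp add: case_prod_unfold bform_zero_right)
    also have "\<dots> = (\<Sum>p\<in>?P. c (fst p) (snd p) * bform I B (v k q) (v (fst p) (snd p)))"
      by (rule bform_sum_right)
    also have "\<dots> = (\<Sum>p\<in>?P. if p = (k, l) then c k l * (if l < ms ! k then - 1 else 1) else 0)"
    proof (intro sum.cong refl)
      fix p assume "p \<in> ?P"
      then obtain k' l' where p: "p = (k', l')" "k' < length ms" "l' < 2 * ms ! k'" by auto
      have "bform I B (v k q) (v k' l') = (if k = k' then skewblk (ms ! k) id_mat q l' else 0)"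
        using gram(2)[OF kl(1) q p(2,3)] .
      then show "c (fst p) (snd p) * bform I B (v k q) (v (fst p) (snd p)) =
          (if p = (k, l) then c k l * (if l < ms ! k then - 1 else 1) else 0)"
        using p sgn by (cases "k = k'") auto
    qed
    also have "\<dots> = c k l * (if l < ms ! k then - 1 else 1)"
      using kl by (subst sum.delta) auto
    finally show ?thesis by (auto split: if_splits)
  qed
  have "card ?P = (\<Sum>k<length ms. 2 * ms ! k)"
    by (subst card_SigmaI) auto
  also have "\<dots> = 2 * sum_list ms"
    by (simp add: sum_list_sum_nth sum_distrib_left atLeast0LessThan)
  finally have "card ?P = card I" by (simp add: card)
  moreover have "v k l i = 0" if "i \<notin> I" for k l i
    using supp that by (simp add: v_def)
  ultimately show ?thesis
    unfolding jk_decomp_def jk_pos_map_Jor v_def[symmetric]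
    using fin indep gram by auto
qed

section \<open>The forms in terms of power series\<close>

lemma gbr_basis_antisym: "gbr_basis s n b a c = - gbr_basis s n a b c"
  by (simp add: gbr_basis_eq)

lemma lie_form_antisym: "lie_form s n x b a = - lie_form s n x a b"
  unfolding lie_form_def by (subst gbr_basis_antisym) (simp add: sum_negf)

lemma not_act_rel_F [simp]: "\<not> act_rel s n (F i k) b c"
  and not_act_rel_E [simp]: "\<not> act_rel s n a (E i j) c"
  by (auto simp: act_rel_def eidx_def fidx_def)

lemma lie_form_same_kind [simp]:
  "lie_form s n x (E i j) (E i' j') = 0" "lie_form s n x (F i j) (F i' j') = 0"
  by (simp_all add: lie_form_def gbr_basis_eq)

text \<open>The span of the e's and the span of the f's are both abelian, hence isotropic for every
  x.\<close>

lemma bform_lie_form_isotropic: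
  assumes "(\<forall>i j. u (E i j) = 0 \<and> w (E i j) = 0) \<or> (\<forall>i j. u (F i j) = 0 \<and> w (F i j) = 0)"
  shows "bform I (lie_form s n x) u w = 0"
proof -
  have "u a * lie_form s n x a b * w b = 0" for a b
    using assms by (cases a; cases b) auto
  then show ?thesis unfolding bform_def by (intro sum.neutral ballI)
qed

text \<open>A functional on R that depends on branch i alone, with value g j on t_i^j. Its
  e_0-coordinate is g 0 because 1 = t_i^0 in every branch.\<close>

definition evec :: "(nat \<Rightarrow> nat) \<Rightarrow> nat \<Rightarrow> (nat \<Rightarrow> complex) \<Rightarrow> gidx \<Rightarrow> complex" where
  "evec n i g c = (case c of
      E i' j \<Rightarrow> if i' = 0 \<and> j = 0 then g 0 else if i' = i \<and> 1 \<le> j \<and> j \<le> n i then g j else 0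
    | F i' k \<Rightarrow> 0)"

text \<open>The family U stands for an element of R, so its members must share one constant term, read off at i = 1.\<close>
definition fvec :: "nat \<Rightarrow> (nat \<Rightarrow> nat) \<Rightarrow> (nat \<Rightarrow> complex fps) \<Rightarrow> gidx \<Rightarrow> complex" where
  "fvec s n U c = (case c of
      E i j \<Rightarrow> 0
    | F i k \<Rightarrow> if i = 0 \<and> k = 0 then U 1 $ 0 else
        if 1 \<le> i \<and> i \<le> s \<and> 1 \<le> k \<and> k \<le> n i then U i $ k else 0)"

lemma evec_eidx: "1 \<le> i \<Longrightarrow> j \<le> n i \<Longrightarrow> evec n i g (eidx i j) = g j"
  by (auto simp: evec_def eidx_def)

lemma evec_eq_0: "c \<notin> eidx i ` {..n i} \<Longrightarrow> evec n i g c = 0"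
  by (force simp: evec_def eidx_def image_iff split: gidx.splits)

lemma fvec_fidx:
  assumes "1 \<le> i" "i \<le> s" "k \<le> n i" "U i $ 0 = U 1 $ 0"
  shows "fvec s n U (fidx i k) = U i $ k"
  using assms by (auto simp: fvec_def fidx_def)

lemma evec_F [simp]: "evec n i g (F i' k) = 0"
  and fvec_E [simp]: "fvec s n U (E i' j) = 0"
  by (simp_all add: evec_def fvec_def)

lemma evec_notin_gbasis:
  assumes "1 \<le> i" "i \<le> s" "c \<notin> gbasis s n" shows "evec n i g c = 0"
  using assms by (intro evec_eq_0) auto

lemma fvec_notin_gbasis: "c \<notin> gbasis s n \<Longrightarrow> fvec s n U c = 0"
  by (auto simp: fvec_def gbasis_def split: gidx.splits)

text \<open>The pairing is a convolution, the t_i^j coefficient of a product in branch i; the sign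
  comes from having the f-vector on the left.\<close>

lemma sum_lie_form_eidx:
  assumes i: "1 \<le> i" "i \<le> s" "j \<le> n i" and u: "\<And>i j. u (E i j) = 0"
  shows "(\<Sum>a\<in>gbasis s n. u a * lie_form s n x a (eidx i j)) =
    - (\<Sum>k\<le>j. u (fidx i k) * x (eidx i (j - k)))"
proof -
  let ?I = "gbasis s n" and ?h = "\<lambda>k. (fidx i k, eidx i (j - k))"
  have "u a * lie_form s n x a (eidx i j) =
      - (\<Sum>c\<in>?I. u a * x c * of_bool (act_rel s n (eidx i j) a c))" for a
    using u by (cases a) (simp_all add: lie_form_def gbr_basis_eq sum_distrib_left sum_negf mult_ac
        del: sum_mult_of_bool_eq sum_of_bool_mult_eq)
  then have "(\<Sum>a\<in>?I. u a * lie_form s n x a (eidx i j)) =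
      - (\<Sum>a\<in>?I. \<Sum>c\<in>?I. u a * x c * of_bool (act_rel s n (eidx i j) a c))"
    by (simp add: sum_negf)
  also have "(\<Sum>a\<in>?I. \<Sum>c\<in>?I. u a * x c * of_bool (act_rel s n (eidx i j) a c)) =
      (\<Sum>p\<in>?I \<times> ?I. u (fst p) * x (snd p) * of_bool (act_rel s n (eidx i j) (fst p) (snd p)))"
    by (simp only: sum.cartesian_product case_prod_unfold)
  also have "\<dots> = (\<Sum>p\<in>?h ` {..j}. u (fst p) * x (snd p) * of_bool (act_rel s n (eidx i j) (fst p) (snd p)))"
    using i by (intro sum.mono_neutral_right) (auto simp: act_rel_eidx_iff)
  also have "\<dots> = (\<Sum>k\<le>j. u (fidx i k) * x (eidx i (j - k)))"
  proof (subst sum.reindex)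
    show "inj_on ?h {..j}" by (auto simp: inj_on_def fidx_eq_iff)
    have "act_rel s n (eidx i j) (fidx i k) (eidx i (j - k))" if "k \<le> j" for k
      using i that by (auto simp: act_rel_def grel_def)
    then show "sum ((\<lambda>p. u (fst p) * x (snd p) * of_bool (act_rel s n (eidx i j) (fst p) (snd p))) \<circ> ?h) {..j} =
        (\<Sum>k\<le>j. u (fidx i k) * x (eidx i (j - k)))"
      by (intro sum.cong) auto
  qed
  finally show ?thesis .
qed

lemma bform_evec:
  assumes i: "1 \<le> i" "i \<le> s" and u: "\<And>i j. u (E i j) = 0"
  shows "bform (gbasis s n) (lie_form s n x) u (evec n i g) =
    - (\<Sum>j\<le>n i. g j * (\<Sum>k\<le>j. u (fidx i k) * x (eidx i (j - k))))"
proof -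
  let ?I = "gbasis s n" and ?G = "\<lambda>b. (\<Sum>a\<in>gbasis s n. u a * lie_form s n x a b)"
  have "bform ?I (lie_form s n x) u (evec n i g) = (\<Sum>b\<in>?I. ?G b * evec n i g b)"
    unfolding bform_def by (subst sum.swap) (simp add: sum_distrib_right)
  also have "\<dots> = (\<Sum>b\<in>eidx i ` {..n i}. ?G b * evec n i g b)"
    using i by (intro sum.mono_neutral_right) (auto simp: evec_eq_0)
  also have "\<dots> = (\<Sum>j\<le>n i. ?G (eidx i j) * evec n i g (eidx i j))"
    by (subst sum.reindex) (auto simp: inj_on_def eidx_eq_iff)
  also have "\<dots> = (\<Sum>j\<le>n i. - (g j * (\<Sum>k\<le>j. u (fidx i k) * x (eidx i (j - k)))))"
    using i by (intro sum.cong refl) (simp add: sum_lie_form_eidx[of i s _ n u, OF _ _ _ u] evec_eidx)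
  finally show ?thesis by (simp add: sum_negf)
qed

text \<open>As \<rho> has no constant term, \<rho>^j starts in degree at least j, so coefficients of
  Z beyond m never reach degree m. Hence the truncation at j \<le> n_i imposed by the finite basis
  loses nothing.\<close>

lemma fps_compose_mult_nth:
  fixes Z H :: "'a::idom fps"
  assumes "\<rho> $ 0 = 0" "m \<le> N"
  shows "((Z oo \<rho>) * H) $ m = (\<Sum>j\<le>N. Z $ j * (\<rho> ^ j * H) $ m)"
proof -
  have comp: "(Z oo \<rho>) $ p = (\<Sum>j\<le>N. Z $ j * \<rho> ^ j $ p)" if "p \<le> m" for p
    unfolding fps_compose_nth using that assms
    by (intro sum.mono_neutral_left) (auto simp: startsby_zero_power_prefix)
  have "((Z oo \<rho>) * H) $ m = (\<Sum>p=0..m. \<Sum>j\<le>N. Z $ j * \<rho> ^ j $ p * H $ (m - p))"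
    by (simp add: fps_mult_nth comp sum_distrib_right)
  also have "\<dots> = (\<Sum>j\<le>N. \<Sum>p=0..m. Z $ j * \<rho> ^ j $ p * H $ (m - p))"
    by (rule sum.swap)
  finally show ?thesis by (simp add: fps_mult_nth sum_distrib_left mult.assoc)
qed

text \<open>The vector in the second argument represents the functional sending y to the coefficient of
  r^m in the expansion of y / Q in powers of r, where \<rho> is the compositional inverse of r.\<close>
lemma bform_fvec_evec:
  assumes i: "1 \<le> i" "i \<le> s" "m \<le> n i" and \<rho>: "\<rho> $ 0 = 0" and Q: "Q $ 0 \<noteq> 0"
    and U: "U i $ 0 = U 1 $ 0" and X: "Abs_fps (\<lambda>j. x (eidx i j)) = Y * Q"
  shows "bform (gbasis s n) (lie_form s n x) (fvec s n U)
      (evec n i (\<lambda>j. (\<rho> ^ j * (inverse Q oo \<rho>)) $ m)) = - ((Y * U i) oo \<rho>) $ m"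
proof -
  have "(\<Sum>k\<le>j. fvec s n U (fidx i k) * x (eidx i (j - k))) = (U i * (Y * Q)) $ j" if "j \<le> n i" for j
    using i U that by (simp add: X[symmetric] fps_mult_nth fvec_fidx atLeast0AtMost)
  then have "bform (gbasis s n) (lie_form s n x) (fvec s n U) (evec n i (\<lambda>j. (\<rho> ^ j * (inverse Q oo \<rho>)) $ m))
      = - (\<Sum>j\<le>n i. (U i * (Y * Q)) $ j * (\<rho> ^ j * (inverse Q oo \<rho>)) $ m)"
    using i by (simp add: bform_evec mult.commute)
  also have "\<dots> = - ((U i * (Y * Q) oo \<rho>) * (inverse Q oo \<rho>)) $ m"
    using fps_compose_mult_nth[OF \<rho> i(3)] by simp
  also have "(U i * (Y * Q) oo \<rho>) * (inverse Q oo \<rho>) = (Y * U i * (Q * inverse Q)) oo \<rho>"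
    using \<rho> by (simp add: fps_compose_mult_distrib mult_ac)
  finally show ?thesis by (simp add: inverse_mult_eq_1'[OF Q])
qed

section \<open>Jordan chains and their dual bases\<close>

text \<open>\<open>a0\<close> makes q a unit in each branch. The linear coefficient of p / q in
  branch i is the expression in \<open>generic\<close> divided by \<open>a (E 0 0) ^ 2\<close>, so
  r_i has a compositional inverse.\<close>

lemma jk_decomp_lie_form:
  assumes s: "1 \<le> s" and n: "\<And>i. 1 \<le> i \<Longrightarrow> i \<le> s \<Longrightarrow> n i \<le> n 1"
    and a0: "a (E 0 0) \<noteq> 0"
    and generic: "\<And>i. 1 \<le> i \<Longrightarrow> i \<le> s \<Longrightarrow> x (E i 1) * a (E 0 0) - x (E 0 0) * a (E i 1) \<noteq> 0"
  shows "\<exists>lam v. jk_decomp (gbasis s n) (lie_form s n x) (lie_form s n a)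
    (Jor lam (n 1 + 1) # map (\<lambda>i. Jor lam (n i)) [2..<Suc s]) v"
proof -
  let ?I = "gbasis s n" and ?A = "lie_form s n x" and ?B = "lie_form s n a"
  \<comment> \<open>The constant term of p / q is the same in all branches, since they share e_0;
    hence the single eigenvalue.\<close>
  define lam where "lam = x (E 0 0) / a (E 0 0)"
  define P where "P i = Abs_fps (\<lambda>j. x (eidx i j))" for i
  define Q where "Q i = Abs_fps (\<lambda>j. a (eidx i j))" for i
  define r where "r i = P i * inverse (Q i) - fps_const lam" for i
  define \<rho> where "\<rho> i = fps_inv (r i)" for i
  define \<phi> where "\<phi> i m = evec n i (\<lambda>j. (\<rho> i ^ j * (inverse (Q i) oo \<rho> i)) $ m)" for i m
  \<comment> \<open>Chain 0 consists of powers of r, taken in all branches at once. Chain k > 0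
    lives in branch k + 1 and starts at exponent 1, as the constant 1 already belongs to chain
    0.\<close>
  define u where "u k l = fvec s n (\<lambda>i. if k = 0 then r i ^ l else if i = Suc k then r i ^ Suc l else 0)"
    for k l
  \<comment> \<open>\<open>\<phi> 1\<close> sees only chain 0, since the other chains vanish in
    branch 1. \<open>\<phi> (Suc k)\<close> sees chain 0 besides chain k, and adding
    \<open>\<phi> 1\<close> cancels that part. The signs undo the minus in
    \<open>bform_fvec_evec\<close>; the value 0 for k \<ge> s keeps the support inside the basis for
    every k.\<close>
  define w where "w k l = (if k < s then
      (if k = 0 then (\<lambda>c. - \<phi> 1 l c) else (\<lambda>c. \<phi> 1 (Suc l) c - \<phi> (Suc k) (Suc l) c))
      else (\<lambda>c. 0))" for k l
  define ms where "ms = (n 1 + 1) # map n [2..<Suc s]"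

  have Q0: "Q i $ 0 \<noteq> 0" for i using a0 by (simp add: Q_def eidx_def)
  have P: "P i = (fps_const lam + r i) * Q i" for i
    using inverse_mult_eq_1[OF Q0[of i]] by (simp add: r_def mult.assoc)
  have r0: "r i $ 0 = 0" for i
    using a0 by (simp add: r_def P_def Q_def eidx_def lam_def field_simps)
  have r1: "r i $ 1 \<noteq> 0" if "1 \<le> i" "i \<le> s" for i
  proof
    assume "r i $ 1 = 0"
    then have "P i $ 1 = lam * Q i $ 1" unfolding P by (simp add: r0)
    then have "x (E i 1) = lam * a (E i 1)" by (simp add: P_def Q_def eidx_def)
    with generic[OF that] a0 show False by (simp add: lam_def)
  qed
  have \<rho>0: "\<rho> i $ 0 = 0" for i by (simp add: \<rho>_def fps_inv_def)
  have r\<rho>: "r i ^ l oo \<rho> i = fps_X ^ l" if "1 \<le> i" "i \<le> s" for i l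
    using fps_inv_right[OF r0 r1[OF that]] fps_compose_power[OF \<rho>0, of "r i" i l] by (simp add: \<rho>_def)

  have pair:
    "bform ?I ?A (u k l) (\<phi> i m) = (if k = 0 \<or> i = Suc k then
       - jordan_mat lam (if k = 0 then l else Suc l) m else 0)"
    "bform ?I ?B (u k l) (\<phi> i m) = (if k = 0 \<or> i = Suc k then
       - id_mat (if k = 0 then l else Suc l) m else 0)"
    if i: "1 \<le> i" "i \<le> s" and m: "m \<le> n i" for i k l m
  proof -
    let ?U = "\<lambda>i. if k = 0 then r i ^ l else if i = Suc k then r i ^ Suc l else 0"
    define L where "L = (if k = 0 then l else Suc l)"
    have U0: "?U i $ 0 = ?U 1 $ 0" by (simp add: r0 fps_power_zeroth)
    have U: "?U i = (if k = 0 \<or> i = Suc k then r i ^ L else 0)" by (simp add: L_def)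
    \<comment> \<open>Composition with \<rho> turns r_i into X, so lam + r sends X^L to lam X^L +
      X^(L+1), whose coefficients are row L of the Jordan matrix.\<close>
    have "((fps_const lam + r i) * r i ^ L) oo \<rho> i = fps_const lam * (r i ^ L oo \<rho> i) + (r i ^ Suc L oo \<rho> i)"
      by (simp only: distrib_right fps_compose_add_distrib fps_compose_mult_distrib[OF \<rho>0] fps_const_compose power_Suc)
    then have L: "(((fps_const lam + r i) * r i ^ L) oo \<rho> i) $ m = jordan_mat lam L m"
      by (simp add: r\<rho>[OF i] jordan_mat_def del: power_Suc)
    have "bform ?I ?A (u k l) (\<phi> i m) = - (((fps_const lam + r i) * ?U i) oo \<rho> i) $ m"
      unfolding u_def \<phi>_def using i m \<rho>0 Q0 U0 P[unfolded P_def] by (rule bform_fvec_evec)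
    also have "\<dots> = (if k = 0 \<or> i = Suc k then - jordan_mat lam L m else 0)"
      unfolding U by (cases "k = 0 \<or> i = Suc k") (simp_all only: if_True if_False L fps_neg_nth mult_zero_right fps_compose_0 fps_zero_nth minus_zero)
    finally show "bform ?I ?A (u k l) (\<phi> i m) = (if k = 0 \<or> i = Suc k then
       - jordan_mat lam (if k = 0 then l else Suc l) m else 0)" unfolding L_def .
    have "bform ?I ?B (u k l) (\<phi> i m) = - ((1 * ?U i) oo \<rho> i) $ m"
      unfolding u_def \<phi>_def using i m \<rho>0 Q0 U0 by (rule bform_fvec_evec) (simp add: Q_def)
    also have "\<dots> = (if k = 0 \<or> i = Suc k then - id_mat L m else 0)"
      unfolding U by (auto simp: r\<rho>[OF i] id_mat_def)
    finally show "bform ?I ?B (u k l) (\<phi> i m) = (if k = 0 \<or> i = Suc k then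
       - id_mat (if k = 0 then l else Suc l) m else 0)" unfolding L_def .
  qed

  have len: "length ms = s" using s by (simp add: ms_def del: upt_Suc)
  have nth: "ms ! k = (if k = 0 then n 1 + 1 else n (Suc k))" if "k < s" for k
    using that by (auto simp: ms_def nth_Cons simp del: upt_Suc split: nat.splits)
  have pair_w: "bform ?I ?A (u k l) (w k' l') = (if k = k' then jordan_mat lam l l' else 0)"
    "bform ?I ?B (u k l) (w k' l') = (if k = k' then id_mat l l' else 0)"
    if k: "k < s" "k' < s" and l: "l < ms ! k" "l' < ms ! k'" for k l k' l'
  proof -
    \<comment> \<open>The last bound, from the maximality of n_1, keeps the correcting term
      \<open>\<phi> 1 (Suc l')\<close> in range.\<close>
    have b: "k' = 0 \<Longrightarrow> l' \<le> n 1" "k' \<noteq> 0 \<Longrightarrow> Suc l' \<le> n (Suc k')" "k' \<noteq> 0 \<Longrightarrow> Suc l' \<le> n 1"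
      using k l n[of "Suc k'"] by (auto simp: nth)
    \<comment> \<open>Entries depend only on the difference of the positions, which absorbs the
      start at exponent 1.\<close>
    have shift: "jordan_mat lam (Suc p) (Suc q) = jordan_mat lam p q" "id_mat (Suc p) (Suc q) = id_mat p q"
      for p q by (simp_all add: jordan_mat_def id_mat_def)
    show "bform ?I ?A (u k l) (w k' l') = (if k = k' then jordan_mat lam l l' else 0)"
      "bform ?I ?B (u k l) (w k' l') = (if k = k' then id_mat l l' else 0)"
      using k b s by (cases "k' = 0"; simp add: w_def bform_minus_right bform_diff_right pair shift; fail)+
  qed

  have blocks: "map (Jor (Some lam)) ms = Jor (Some lam) (n 1 + 1) # map (\<lambda>i. Jor (Some lam) (n i)) [2..<Suc s]"
    by (simp add: ms_def del: upt_Suc)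
  have "jk_decomp ?I ?A ?B (map (Jor (Some lam)) ms)
      (\<lambda>k l. if l < ms ! k then u k l else w k (l - ms ! k))"
  proof (rule jk_decomp_JorI)
    have "{1..s} = insert 1 {2..<Suc s}" using s by auto
    then have "(\<Sum>i=1..s. n i) = n 1 + (\<Sum>i=2..<Suc s. n i)" by simp
    then show "card ?I = 2 * sum_list ms"
      by (simp add: card_gbasis ms_def sum_set_upt_conv_sum_list_nat[symmetric] del: upt_Suc)
    have w_F: "w k l (F i j) = 0" for k l i j by (simp add: w_def \<phi>_def)
    show "bform ?I ?A (u k l) (u k' l') = 0" "bform ?I ?B (u k l) (u k' l') = 0" for k l k' l'
      by (simp_all add: bform_lie_form_isotropic u_def)
    show "bform ?I ?A (w k l) (w k' l') = 0" "bform ?I ?B (w k l) (w k' l') = 0" for k l k' l'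
      by (simp_all add: bform_lie_form_isotropic w_F)
    show "u k l i = 0" if "i \<notin> ?I" for k l i
      using that by (simp add: u_def fvec_notin_gbasis)
    show "w k l i = 0" if "i \<notin> ?I" for k l i
      using that s by (auto simp: w_def \<phi>_def evec_notin_gbasis[of _ s])
    show "?A j i = - ?A i j" "?B j i = - ?B i j" for i j by (rule lie_form_antisym)+
    show "bform ?I ?A (u k l) (w k' l') = (if k = k' then jordan_mat lam l l' else 0)"
      "bform ?I ?B (u k l) (w k' l') = (if k = k' then id_mat l l' else 0)"
      if "k < length ms" "k' < length ms" "l < ms ! k" "l' < ms ! k'" for k l k' l'
      using pair_w[of k k' l l'] that unfolding len by blast+
  qed simp
  then show ?thesis unfolding blocks by blast
qed

section \<open>The nonempty open set of generic pairs\<close>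

lemma poly_on_prod: "finite S \<Longrightarrow> (\<And>i. i \<in> S \<Longrightarrow> poly_on I (p i)) \<Longrightarrow> poly_on I (\<lambda>z. \<Prod>i\<in>S. p i z)"
proof (induction S rule: finite_induct)
  case empty
  show ?case by (simp add: pconst)
next
  case (insert i S)
  then show ?case by (simp add: pmult)
qed

theorem theorem7:
  fixes s :: nat and n :: "nat \<Rightarrow> nat"
  assumes "1 \<le> s"
    and "\<forall>i. 1 \<le> i \<and> i \<le> s \<longrightarrow> 0 < n i"
    and "\<forall>i j. 1 \<le> i \<and> i \<le> j \<and> j \<le> s \<longrightarrow> n j \<le> n i"
  shows "lie_algebra (gspace s n) (gbr s n) \<and>
    (\<exists>U. zariski_open (gbasis s n <+> gbasis s n) U \<and> U \<noteq> {} \<and>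
       (\<forall>z\<in>U. \<exists>lam v. jk_decomp (gbasis s n)
            (lie_form s n (z \<circ> Inl)) (lie_form s n (z \<circ> Inr))
            (Jor lam (n 1 + 1) # map (\<lambda>i. Jor lam (n i)) [2..<Suc s]) v))"
proof (intro conjI lie_algebra_gspace exI)
  let ?J = "gbasis s n <+> gbasis s n"
  \<comment> \<open>The genericity condition as a polynomial, with the difference spelled out by the
    sums and products that generate \<open>poly_on\<close>.\<close>
  define d :: "nat \<Rightarrow> (gidx + gidx \<Rightarrow> complex) \<Rightarrow> complex" where
    "d i z = z (Inl (E i 1)) * z (Inr (E 0 0)) + - 1 * (z (Inl (E 0 0)) * z (Inr (E i 1)))" for i z
  define p where "p z = z (Inr (E 0 0)) * (\<Prod>i=1..s. d i z)" for z
  define U where "U = {z \<in> aff ?J. p z \<noteq> 0}"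
  \<comment> \<open>Positivity of n_i ensures that e^i_1 is a basis element, so d i involves only
    actual coordinates.\<close>
  have mem: "E 0 0 \<in> gbasis s n" "1 \<le> i \<Longrightarrow> i \<le> s \<Longrightarrow> E i 1 \<in> gbasis s n" for i
    using assms(2) by (auto simp: gbasis_def Suc_le_eq)
  have "poly_on ?J (d i)" if "i \<in> {1..s}" for i
    unfolding d_def using that mem by (intro padd pmult pconst pcoord) auto
  then have "poly_on ?J p"
    unfolding p_def using mem by (intro pmult pcoord poly_on_prod) auto
  then show "zariski_open ?J U"
    unfolding zariski_open_def U_def by (intro exI[of _ "{p}"]) auto
  \<comment> \<open>Here q = 1 and p is the sum of the t_i, so r_i = t_i and every
    \<open>d i\<close> is 1.\<close>
  define z0 :: "gidx + gidx \<Rightarrow> complex" where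
    "z0 c = of_bool (c = Inr (E 0 0) \<or> (\<exists>i\<in>{1..s}. c = Inl (E i 1)))" for c
  have "d i z0 = 1" if "i \<in> {1..s}" for i
    using that by (auto simp: d_def z0_def)
  then have "p z0 = 1" by (simp add: p_def) (simp add: z0_def)
  moreover have "z0 \<in> aff ?J" using mem by (auto simp: aff_def z0_def)
  ultimately show "U \<noteq> {}" by (auto simp: U_def)
  show "\<forall>z\<in>U. \<exists>lam v. jk_decomp (gbasis s n) (lie_form s n (z \<circ> Inl)) (lie_form s n (z \<circ> Inr))
      (Jor lam (n 1 + 1) # map (\<lambda>i. Jor lam (n i)) [2..<Suc s]) v"
  proof
    fix z assume "z \<in> U"
    then have nz: "z (Inr (E 0 0)) \<noteq> 0" "\<And>i. 1 \<le> i \<Longrightarrow> i \<le> s \<Longrightarrow> d i z \<noteq> 0"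
      by (auto simp: U_def p_def)
    show "\<exists>lam v. jk_decomp (gbasis s n) (lie_form s n (z \<circ> Inl)) (lie_form s n (z \<circ> Inr))
        (Jor lam (n 1 + 1) # map (\<lambda>i. Jor lam (n i)) [2..<Suc s]) v"
      using assms nz by (intro jk_decomp_lie_form) (auto simp: d_def)
  qed
qed

end
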